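(* Let $k_1,k_2$ be non-negative integers and let $\Omega_{3,7}=(B,\mathbf x,R,\mathbf Z)$ be the seed with $$B=\begin{bmatrix}0&1&-1\\-1&0&2\\1&-2&0\end{bmatrix},\quad R=\mathrm{diag}(4,1,1),\quad Z_1(u)=1+k_1u+k_2u^2+k_1u^3+u^4,\ Z_2(u)=Z_3(u)=1+u.$$ Then for all $a,b\in\mathbb Q$ with $a\ne0$, the Laurent polynomial $$F_{3,7}(\mathbf x)=a\,\frac{x_1^2+x_2^4+x_3^4+2x_1(x_2^2+x_3^2)+k_1x_2x_3(x_1+x_2^2+x_3^2)+k_2x_2^2x_3^2}{x_1x_2^2x_3^2}+b$$ belongs to the invariant Laurent polynomial ring $\mathbb Q[\mathbf x^{\pm}]^{\langle\mu_1,\mu_2,\mu_3\rangle}$, where $\mu_1,\mu_2,\mu_3\in\mathcal S(\Omega_{3,7})$.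
   Context: A seed (rank 3) is $\Omega=(B,\mathbf x,R,\mathbf Z)$ with $B=(b_{ij})$ a skew-symmetrizable integer matrix, $\mathbf x=(x_1,x_2,x_3)$ free generators of $\mathbb Q(x_1,x_2,x_3)$, $R=\mathrm{diag}(r_1,r_2,r_3)$ with positive integers, and $\mathbf Z=(Z_1,Z_2,Z_3)$ with $Z_k(u)=\sum_{i=0}^{r_k}z_{k,i}u^i\in\mathbb Z_{\ge0}[u]$, $z_{k,i}=z_{k,r_k-i}$, $z_{k,0}=z_{k,r_k}=1$. With $B_s=(b_{1s},b_{2s},b_{3s})$ and $[\cdot]_+=\max\{\cdot,0\}$ componentwise, put $P_{\Omega,s}(\mathbf x)=\sum_{i=0}^{r_s}z_{s,i}\mathbf x^{i[B_s]_++(r_s-i)[-B_s]_+}$. The mutation $\mu_s$ sends $(B,\mathbf x,R,\mathbf Z)$ to $(B',\mathbf x',R,\mathbf Z)$ with $b'_{ij}=-b_{ij}$ if $i=s$ or $j=s$, $b'_{ij}=b_{ij}+r_s([b_{is}]_+b_{sj}+b_{is}[-b_{sj}]_+)$ otherwise, $x'_s=P_{\Omega,s}(\mathbf x)/x_s$, and $x'_j=x_j$ for $j\ne s$. $\mathcal S(\Omega)$ is the set of all $\sigma\mu_s$ (first $\mu_s$, then the index permutation $\sigma$) sending $(B,\mathbf x,R,\mathbf Z)$ to $(\pm B,\mathbf x',R,\mathbf Z)$ for some $\mathbf x'$. $\mathbb Q[\mathbf x^{\pm}]^{G}=\{F\in\mathbb Q[\mathbf x^{\pm}]\mid F(g(\mathbf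 x))=F(\mathbf x)\ \forall g\in G\}$, where elements of $\mathcal S(\Omega)$ act through the induced map on clusters. *)

theory Defs
  imports
    "HOL-Analysis.Analysis"
    "HOL-Algebra.Bij"
    "HOL-Algebra.Generated_Groups"
    "HOL-Library.Poly_Mapping"
    "HOL-Computational_Algebra.Polynomial"
begin

text \<open>
  The ambient field \<open>'k\<close> plays the role of \<open>\<rat>(x\<^sub>1,x\<^sub>2,x\<^sub>3)\<close>: this is what the existence of a
  triple of free generators (below) says about it. All objects of rank three are indexed by the
  three-element type \<open>3\<close>, whose elements are \<open>1\<close>, \<open>2\<close> and \<open>3\<close>.
\<close>

subsection \<open>Polynomials and Laurent polynomials over the rationals in three variables\<close>

text \<open>A (Laurent) polynomial is the finitely supported map from exponent vectors to coefficients.\<close>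

type_synonym polynomial3 = "(nat^3) \<Rightarrow>\<^sub>0 rat"

type_synonym laurent3 = "(int^3) \<Rightarrow>\<^sub>0 rat"

definition poly_eval :: "polynomial3 \<Rightarrow> 'k::field_char_0^3 \<Rightarrow> 'k" where
  "poly_eval p y =
     (\<Sum>m\<in>Poly_Mapping.keys p. of_rat (Poly_Mapping.lookup p m) * (\<Prod>i\<in>UNIV. (y $ i) ^ (m $ i)))"

definition laurent_eval :: "laurent3 \<Rightarrow> 'k::field_char_0^3 \<Rightarrow> 'k" where
  "laurent_eval F y =
     (\<Sum>m\<in>Poly_Mapping.keys F. of_rat (Poly_Mapping.lookup F m) * (\<Prod>i\<in>UNIV. (y $ i) powi (m $ i)))"

definition lmonom :: "int^3 \<Rightarrow> laurent3" where
  "lmonom m = Poly_Mapping.single m 1"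

definition lvar :: "3 \<Rightarrow> laurent3" where
  "lvar i = lmonom (axis i 1)"

definition lconst :: "rat \<Rightarrow> laurent3" where
  "lconst c = Poly_Mapping.single 0 c"

text \<open>Algebraically independent over the rationals, and generating the ambient field.\<close>

definition free_generators :: "'k::field_char_0^3 \<Rightarrow> bool" where
  "free_generators x \<longleftrightarrow>
     (\<forall>p. poly_eval p x = 0 \<longrightarrow> p = 0) \<and>
     (\<forall>z. \<exists>p q. poly_eval q x \<noteq> 0 \<and> z = poly_eval p x / poly_eval q x)"

subsection \<open>Seeds\<close>

text \<open>The diagonal matrix \<open>R\<close> is stored as the vector of its diagonal entries.\<close>

record 'k seed =
  exmat :: "int^3^3"
  cluster :: "'k^3"
  rdeg :: "nat^3"
  mutpoly :: "(nat poly)^3"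

definition skew_symmetrizable :: "int^3^3 \<Rightarrow> bool" where
  "skew_symmetrizable B \<longleftrightarrow>
     (\<exists>d::int^3. (\<forall>i. d $ i > 0) \<and> (\<forall>i j. d $ i * B $ i $ j = - (d $ j * B $ j $ i)))"

definition is_seed :: "'k::field_char_0 seed \<Rightarrow> bool" where
  "is_seed \<Omega> \<longleftrightarrow>
     skew_symmetrizable (exmat \<Omega>) \<and>
     free_generators (cluster \<Omega>) \<and>
     (\<forall>k. rdeg \<Omega> $ k > 0) \<and>
     (\<forall>k. degree (mutpoly \<Omega> $ k) = rdeg \<Omega> $ k \<and>
          (\<forall>i\<le>rdeg \<Omega> $ k. coeff (mutpoly \<Omega> $ k) i = coeff (mutpoly \<Omega> $ k) (rdeg \<Omega> $ k - i)) \<and>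
          coeff (mutpoly \<Omega> $ k) 0 = 1 \<and> coeff (mutpoly \<Omega> $ k) (rdeg \<Omega> $ k) = 1)"

definition seeds :: "'k::field_char_0 seed set" where
  "seeds = {\<Omega>. is_seed \<Omega>}"

definition pos_part :: "int \<Rightarrow> int" where
  "pos_part n = max n 0"

subsection \<open>Mutations and permutations\<close>

definition exchange_poly :: "'k::field_char_0 seed \<Rightarrow> 3 \<Rightarrow> 'k" where
  "exchange_poly \<Omega> s =
     (\<Sum>i\<le>rdeg \<Omega> $ s. of_nat (coeff (mutpoly \<Omega> $ s) i) *
        (\<Prod>j\<in>UNIV. (cluster \<Omega> $ j) powi
           (int i * pos_part (exmat \<Omega> $ j $ s) +
            int (rdeg \<Omega> $ s - i) * pos_part (- (exmat \<Omega> $ j $ s)))))"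

definition mutate :: "3 \<Rightarrow> 'k::field_char_0 seed \<Rightarrow> 'k seed" where
  "mutate s \<Omega> = \<Omega>\<lparr>
     exmat := (let B = exmat \<Omega> in \<chi> i j.
       if i = s \<or> j = s then - (B $ i $ j)
       else B $ i $ j + int (rdeg \<Omega> $ s) *
              (pos_part (B $ i $ s) * B $ s $ j + B $ i $ s * pos_part (- (B $ s $ j)))),
     cluster := (\<chi> j. if j = s then exchange_poly \<Omega> s / cluster \<Omega> $ s else cluster \<Omega> $ j)\<rparr>"

text \<open>A permutation of the indices relabels all the data of a seed simultaneously.\<close>

definition permute_seed :: "(3 \<Rightarrow> 3) \<Rightarrow> 'k seed \<Rightarrow> 'k seed" where
  "permute_seed \<sigma> \<Omega> = \<lparr>
     exmat = (\<chi> i j. exmat \<Omega> $ \<sigma> i $ \<sigma> j),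
     cluster = (\<chi> i. cluster \<Omega> $ \<sigma> i),
     rdeg = (\<chi> i. rdeg \<Omega> $ \<sigma> i),
     mutpoly = (\<chi> i. mutpoly \<Omega> $ \<sigma> i)\<rparr>"

text \<open>
  Seed transformations are restricted to the set of seeds, so that they are elements of the group
  \<^term>\<open>BijGroup seeds\<close> of bijections of that set; outside of it (for instance, when a cluster
  variable is \<open>0\<close>) mutation is not invertible.
\<close>

definition mutation :: "3 \<Rightarrow> 'k::field_char_0 seed \<Rightarrow> 'k seed" where
  "mutation s = restrict (mutate s) seeds"

definition perm_mutation :: "(3 \<Rightarrow> 3) \<Rightarrow> 3 \<Rightarrow> 'k::field_char_0 seed \<Rightarrow> 'k seed" where
  "perm_mutation \<sigma> s = restrict (permute_seed \<sigma> \<circ> mutate s) seeds"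

definition mutation_symmetries ::
    "'k::field_char_0 seed \<Rightarrow> ('k seed \<Rightarrow> 'k seed) set" where
  "mutation_symmetries \<Omega> =
     {perm_mutation \<sigma> s | \<sigma> s. bij \<sigma> \<and>
        (\<exists>B' x'. (B' = exmat \<Omega> \<or> B' = - exmat \<Omega>) \<and>
           perm_mutation \<sigma> s \<Omega> =
             \<lparr>exmat = B', cluster = x', rdeg = rdeg \<Omega>, mutpoly = mutpoly \<Omega>\<rparr>)}"

subsection \<open>Invariant Laurent polynomials\<close>

definition generated_group ::
    "('k::field_char_0 seed \<Rightarrow> 'k seed) set \<Rightarrow> ('k seed \<Rightarrow> 'k seed) set" where
  "generated_group S = generate (BijGroup seeds) S"

text \<open>For a seed transformation \<open>g\<close>, the cluster \<open>g(\<^bold>x)\<close> is that of the seed \<open>g(\<Omega>)\<close>.\<close>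

definition invariant_laurent_ring ::
    "'k::field_char_0 seed \<Rightarrow> ('k seed \<Rightarrow> 'k seed) set \<Rightarrow> laurent3 set" where
  "invariant_laurent_ring \<Omega> G =
     {F. \<forall>g\<in>G. laurent_eval F (cluster (g \<Omega>)) = laurent_eval F (cluster \<Omega>)}"

subsection \<open>The seed and the Laurent polynomial under consideration\<close>

definition Omega37 :: "nat \<Rightarrow> nat \<Rightarrow> 'k::field_char_0^3 \<Rightarrow> 'k seed" where
  "Omega37 k1 k2 x = \<lparr>
     exmat = vector [vector [0, 1, -1], vector [-1, 0, 2], vector [1, -2, 0]],
     cluster = x,
     rdeg = vector [4, 1, 1],
     mutpoly = vector [[:1, k1, k2, k1, 1:], [:1, 1:], [:1, 1:]]\<rparr>"

text \<open>Division by \<open>x\<^sub>1x\<^sub>2\<^sup>2x\<^sub>3\<^sup>2\<close> is multiplication by the monomial with the opposite exponents.\<close>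

definition F37 :: "nat \<Rightarrow> nat \<Rightarrow> rat \<Rightarrow> rat \<Rightarrow> laurent3" where
  "F37 k1 k2 a b =
     (let x1 = lvar 1; x2 = lvar 2; x3 = lvar 3 in
      lconst a *
        ((x1^2 + x2^4 + x3^4 + 2 * x1 * (x2^2 + x3^2)
          + of_nat k1 * x2 * x3 * (x1 + x2^2 + x3^2)
          + of_nat k2 * x2^2 * x3^2)
         * lmonom (vector [-1, -2, -2]))
      + lconst b)"

lemma lmonom_mult: "lmonom m * lmonom n = lmonom (m + n)"
  by (simp add: lmonom_def mult_single)

lemma denominator37:
  "lmonom (vector [-1, -2, -2]) * (lvar 1 * (lvar 2)^2 * (lvar 3)^2) = 1"
proof -
  have "vector [-1, -2, -2] + (axis 1 1 + (axis 2 1 + axis 2 1) + (axis 3 1 + axis 3 1)) = (0::int^3)"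
    by (simp add: vec_eq_iff forall_3 axis_def)
  moreover have "lmonom 0 = 1"
    by (simp add: lmonom_def single_one)
  ultimately show ?thesis
    by (simp add: lvar_def power2_eq_square lmonom_mult)
qed

lemma is_seed_Omega37:
  assumes "free_generators x"
  shows "is_seed (Omega37 k1 k2 x)"
proof -
  have sk: "skew_symmetrizable (exmat (Omega37 k1 k2 x))"
    unfolding skew_symmetrizable_def
    by (rule exI[of _ "\<chi> i. 1"]) (simp add: Omega37_def forall_3)
  have 4: "i = 0 \<or> i = 1 \<or> i = 2 \<or> i = 3 \<or> i = 4" if "i \<le> 4" for i :: nat
    using that by arith
  have Z1: "coeff [:1, k1, k2, k1, 1:] i = coeff [:1, k1, k2, k1, 1:] (4 - i)" if "i \<le> 4" for i
    using 4[OF that] by (elim disjE) (simp_all add: numeral_eq_Suc)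
  have Z23: "coeff [:1, 1::nat:] i = coeff [:1, 1:] (1 - i)" if "i \<le> 1" for i
    using that by (cases i) simp_all
  have c4: "coeff [:1, k1, k2, k1, 1:] 4 = 1"
    by (simp add: numeral_eq_Suc)
  have c1: "coeff [:1, 1::nat:] 1 = 1"
    by simp
  have deg: "degree [:1, k1, k2, k1, 1:] = 4" "degree [:1, 1::nat:] = 1"
    by (simp_all add: numeral_eq_Suc)
  have "(degree (mutpoly (Omega37 k1 k2 x) $ k) = rdeg (Omega37 k1 k2 x) $ k \<and>
          (\<forall>i\<le>rdeg (Omega37 k1 k2 x) $ k. coeff (mutpoly (Omega37 k1 k2 x) $ k) i =
             coeff (mutpoly (Omega37 k1 k2 x) $ k) (rdeg (Omega37 k1 k2 x) $ k - i)) \<and>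
          coeff (mutpoly (Omega37 k1 k2 x) $ k) 0 = 1 \<and>
          coeff (mutpoly (Omega37 k1 k2 x) $ k) (rdeg (Omega37 k1 k2 x) $ k) = 1) \<and>
        0 < rdeg (Omega37 k1 k2 x) $ k" for k
    using exhaust_3[of k]
  proof (elim disjE)
    assume k: "k = 1"
    have eqs: "rdeg (Omega37 k1 k2 x) $ k = 4" "mutpoly (Omega37 k1 k2 x) $ k = [:1, k1, k2, k1, 1:]"
      by (simp_all add: k Omega37_def)
    show ?thesis
      unfolding eqs using Z1 c4 deg(1) coeff_pCons_0 zero_less_numeral by blast
  next
    assume k: "k = 2"
    have eqs: "rdeg (Omega37 k1 k2 x) $ k = 1" "mutpoly (Omega37 k1 k2 x) $ k = [:1, 1:]"
      by (simp_all add: k Omega37_def)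
    show ?thesis
      unfolding eqs using Z23 c1 deg(2) coeff_pCons_0 zero_less_one by blast
  next
    assume k: "k = 3"
    have eqs: "rdeg (Omega37 k1 k2 x) $ k = 1" "mutpoly (Omega37 k1 k2 x) $ k = [:1, 1:]"
      by (simp_all add: k Omega37_def)
    show ?thesis
      unfolding eqs using Z23 c1 deg(2) coeff_pCons_0 zero_less_one by blast
  qed
  moreover have "free_generators (cluster (Omega37 k1 k2 x))"
    using assms by (simp add: Omega37_def)
  ultimately show ?thesis
    using sk unfolding is_seed_def by blast
qed

end

theory Submission
  imports Defs
begin

text \<open>
  At every seed with exchange matrix \<open>\<plusminus>B\<close>, mutation in direction \<open>s\<close> only changes the sign of the
  matrix, and its exchange polynomial \<open>P\<close> does not depend on that sign. As a function of \<open>x\<^sub>s\<close> alone,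
  \<open>F\<close> depends only on \<open>x\<^sub>s + P / x\<^sub>s\<close>, so it is unchanged by \<open>x\<^sub>s \<mapsto> P / x\<^sub>s\<close>. As the sign of the matrix
  alternates, the set of all seeds with matrix \<open>\<plusminus>B\<close> and the given value of \<open>F\<close> is preserved by the
  generators. To pass to the generated group, the mutations must be genuine elements of the group of
  bijections of the set of seeds: they are involutions, once one knows that replacing \<open>x\<^sub>s\<close> by
  \<open>P / x\<^sub>s\<close> yields free generators again.
\<close>

subsection \<open>Evaluation of polynomials and Laurent polynomials\<close>

text \<open>Common form of \<open>poly_eval\<close> and \<open>laurent_eval\<close>: the values
  \<open>h\<close> of the monomials are left arbitrary, so that additivity and multiplicativity are
  proved once for both.\<close>

definition pm_eval :: "('a \<Rightarrow> 'k::field_char_0) \<Rightarrow> ('a \<Rightarrow>\<^sub>0 rat) \<Rightarrow> 'k" where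
  "pm_eval h p = (\<Sum>m\<in>Poly_Mapping.keys p. of_rat (Poly_Mapping.lookup p m) * h m)"

lemma pm_eval_superset:
  assumes "finite A" "Poly_Mapping.keys p \<subseteq> A"
  shows "pm_eval h p = (\<Sum>m\<in>A. of_rat (Poly_Mapping.lookup p m) * h m)"
  unfolding pm_eval_def
  by (rule sum.mono_neutral_left) (use assms in \<open>auto simp: in_keys_iff\<close>)

lemma pm_eval_zero [simp]: "pm_eval h 0 = 0"
  by (simp add: pm_eval_def)

lemma pm_eval_single [simp]: "pm_eval h (Poly_Mapping.single m c) = of_rat c * h m"
  by (simp add: pm_eval_superset[of "{m}"])

lemma pm_eval_add: "pm_eval h (p + q) = pm_eval h p + pm_eval h q"
proof -
  let ?A = "Poly_Mapping.keys p \<union> Poly_Mapping.keys q"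
  have "pm_eval h r = (\<Sum>m\<in>?A. of_rat (Poly_Mapping.lookup r m) * h m)"
    if "Poly_Mapping.keys r \<subseteq> ?A" for r
    using that by (simp add: pm_eval_superset)
  then show ?thesis
    by (simp add: keys_add lookup_add of_rat_add distrib_right sum.distrib)
qed

lemma pm_eval_sum: "pm_eval h (\<Sum>i\<in>I. p i) = (\<Sum>i\<in>I. pm_eval h (p i))"
  by (induction I rule: infinite_finite_induct) (simp_all add: pm_eval_add)

lemma poly_mapping_monomials:
  fixes p :: "'a \<Rightarrow>\<^sub>0 'b::comm_monoid_add"
  shows "p = (\<Sum>m\<in>Poly_Mapping.keys p. Poly_Mapping.single m (Poly_Mapping.lookup p m))"
  by (rule poly_mapping_eqI) (auto simp: lookup_sum lookup_single when_def in_keys_iff)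

text \<open>After both factors are expanded into monomials, bilinearity leaves only the
  multiplicativity of \<open>h\<close> to be used.\<close>

lemma pm_eval_mult:
  fixes p q :: "'a::comm_monoid_add \<Rightarrow>\<^sub>0 rat"
  assumes "\<And>a b. h (a + b) = h a * h b"
  shows "pm_eval h (p * q) = pm_eval h p * pm_eval h q"
proof -
  let ?s = "\<lambda>p::'a \<Rightarrow>\<^sub>0 rat. \<lambda>m. Poly_Mapping.single m (Poly_Mapping.lookup p m)"
  have "p * q = (\<Sum>a\<in>Poly_Mapping.keys p. ?s p a) * (\<Sum>b\<in>Poly_Mapping.keys q. ?s q b)"
    using poly_mapping_monomials[of p] poly_mapping_monomials[of q] by simp
  also have "pm_eval h \<dots> = (\<Sum>a\<in>Poly_Mapping.keys p. \<Sum>b\<in>Poly_Mapping.keys q.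
      (of_rat (Poly_Mapping.lookup p a) * h a) * (of_rat (Poly_Mapping.lookup q b) * h b))"
    by (simp add: sum_product pm_eval_sum mult_single assms of_rat_mult mult_ac)
  also have "\<dots> = pm_eval h p * pm_eval h q"
    by (simp add: pm_eval_def sum_product)
  finally show ?thesis .
qed

definition pmon :: "'k::field_char_0^3 \<Rightarrow> nat^3 \<Rightarrow> 'k" where
  "pmon y m = (\<Prod>i\<in>UNIV. (y $ i) ^ (m $ i))"

lemma pmon_0 [simp]: "pmon y 0 = 1"
  by (simp add: pmon_def)

lemma pmon_add: "pmon y (m + n) = pmon y m * pmon y n"
  by (simp add: pmon_def power_add prod.distrib)

lemma pmon_axis: "pmon y (axis s k) = (y $ s) ^ k"
proof -
  have "pmon y (axis s k) = (\<Prod>i\<in>UNIV. if i = s then (y $ s) ^ k else 1)"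
    unfolding pmon_def by (rule prod.cong) (auto simp: axis_def)
  then show ?thesis by simp
qed

lemma pmon_cong:
  assumes "m $ s = 0" "\<And>j. j \<noteq> s \<Longrightarrow> x $ j = y $ j"
  shows "pmon x m = pmon y m"
  unfolding pmon_def
proof (rule prod.cong)
  fix i show "x $ i ^ m $ i = y $ i ^ m $ i"
    using assms by (cases "i = s") auto
qed simp

lemma poly_eval_pm_eval: "poly_eval p y = pm_eval (pmon y) p"
  by (simp add: poly_eval_def pm_eval_def pmon_def)

lemma poly_eval_single [simp]: "poly_eval (Poly_Mapping.single m c) y = of_rat c * pmon y m"
  by (simp add: poly_eval_pm_eval)

lemma poly_eval_add: "poly_eval (p + q) y = poly_eval p y + poly_eval q y"
  by (simp add: poly_eval_pm_eval pm_eval_add)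

lemma poly_eval_sum: "poly_eval (\<Sum>i\<in>I. p i) y = (\<Sum>i\<in>I. poly_eval (p i) y)"
  by (simp add: poly_eval_pm_eval pm_eval_sum)

lemma poly_eval_mult: "poly_eval (p * q) y = poly_eval p y * poly_eval q y"
  by (simp add: poly_eval_pm_eval pm_eval_mult pmon_add)

lemma laurent_eval_pm_eval:
  "laurent_eval F y = pm_eval (\<lambda>m. \<Prod>i\<in>UNIV. (y $ i) powi (m $ i)) F"
  by (simp add: laurent_eval_def pm_eval_def)

lemma laurent_eval_add: "laurent_eval (F + G) y = laurent_eval F y + laurent_eval G y"
  by (simp add: laurent_eval_pm_eval pm_eval_add)

text \<open>At a zero coordinate, \<open>powi\<close> does not turn sums of exponents into products:
  \<open>0 powi 1 * 0 powi (-1)\<close> is \<open>0\<close>, whereas \<open>0 powi 0\<close> is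
  \<open>1\<close>. Hence the hypothesis.\<close>

lemma laurent_eval_mult:
  assumes "\<And>i. y $ i \<noteq> 0"
  shows "laurent_eval (F * G) y = laurent_eval F y * laurent_eval G y"
  using assms by (simp add: laurent_eval_pm_eval pm_eval_mult power_int_add prod.distrib)

lemma laurent_eval_lconst [simp]: "laurent_eval (lconst c) y = of_rat c"
  by (simp add: laurent_eval_pm_eval lconst_def)

lemma laurent_eval_lmonom [simp]:
  "laurent_eval (lmonom m) y = (\<Prod>i\<in>UNIV. (y $ i) powi (m $ i))"
  by (simp add: laurent_eval_pm_eval lmonom_def)

lemma laurent_eval_lvar [simp]: "laurent_eval (lvar s) y = y $ s"
proof -
  have "laurent_eval (lvar s) y = (\<Prod>i\<in>UNIV. if i = s then y $ s else 1)"
    unfolding lvar_def laurent_eval_lmonom by (rule prod.cong) (auto simp: axis_def)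
  then show ?thesis by simp
qed

lemma laurent_eval_of_nat [simp]: "laurent_eval (of_nat n) y = of_nat n"
  by (simp add: laurent_eval_pm_eval flip: single_of_nat)

lemma laurent_eval_numeral [simp]: "laurent_eval (numeral n) y = numeral n"
  by (metis laurent_eval_of_nat of_nat_numeral)

lemma laurent_eval_power:
  assumes "\<And>i. y $ i \<noteq> 0"
  shows "laurent_eval (F ^ n) y = laurent_eval F y ^ n"
proof (induction n)
  case 0
  show ?case
    using laurent_eval_of_nat[of 1 y] by simp
next
  case (Suc n)
  then show ?case
    using assms by (simp add: laurent_eval_mult)
qed

subsection \<open>Exchanging one of the free generators\<close>

definition alg_indep :: "'k::field_char_0^3 \<Rightarrow> bool" where
  "alg_indep x \<longleftrightarrow> (\<forall>p. poly_eval p x = 0 \<longrightarrow> p = 0)"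

definition frac_field :: "'k::field_char_0^3 \<Rightarrow> 'k set" where
  "frac_field x = {poly_eval p x / poly_eval q x | p q. poly_eval q x \<noteq> 0}"

text \<open>The subring generated over the rationals by the coordinates other than
  \<open>x $ s\<close>. It contains the exchange polynomial and the coefficients of the univariate
  relations considered below.\<close>

definition rest_polys :: "'k::field_char_0^3 \<Rightarrow> 3 \<Rightarrow> 'k set" where
  "rest_polys x s = {poly_eval q x | q. \<forall>m\<in>Poly_Mapping.keys q. m $ s = 0}"

lemma free_generators_iff: "free_generators x \<longleftrightarrow> alg_indep x \<and> frac_field x = UNIV"
  by (simp add: free_generators_def alg_indep_def frac_field_def set_eq_iff conj_commute)

text \<open>Injectivity of \<open>h\<close> prevents terms from merging, so each \<open>c i\<close>
  is itself a coefficient of a polynomial vanishing at \<open>x\<close>.\<close>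

lemma alg_indep_family:
  assumes "alg_indep x" "finite I" "inj_on h I"
    and "(\<Sum>i\<in>I. of_rat (c i) * pmon x (h i)) = 0" and i: "i \<in> I"
  shows "c i = 0"
proof -
  let ?q = "\<Sum>j\<in>I. Poly_Mapping.single (h j) (c j)"
  have "poly_eval ?q x = 0"
    using assms(4) by (simp add: poly_eval_sum)
  then have "?q = 0"
    using assms(1) by (simp only: alg_indep_def)
  then have "Poly_Mapping.lookup ?q (h i) = 0"
    by simp
  moreover have "Poly_Mapping.lookup ?q (h i) = (\<Sum>j\<in>I. if j = i then c j else 0)"
    unfolding lookup_sum
    by (rule sum.cong) (use assms(3) i in \<open>auto simp: lookup_single when_def inj_on_def\<close>)
  ultimately show ?thesis
    using assms(2) i by simp
qed

lemma alg_indep_nonzero: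
  assumes "alg_indep x"
  shows "x $ s \<noteq> 0"
proof
  assume "x $ s = 0"
  then have "(1::rat) = 0"
    using alg_indep_family[OF assms, of "{0::nat}" "\<lambda>_. axis s 1" "\<lambda>_. 1"] by (simp add: pmon_axis)
  then show False by simp
qed

section \<open>The subring of polynomials in the other two variables\<close>

lemma rest_polys_cong:
  assumes "\<And>j. j \<noteq> s \<Longrightarrow> x $ j = y $ j"
  shows "rest_polys x s = rest_polys y s"
proof -
  have "poly_eval q x = poly_eval q y" if "\<forall>m\<in>Poly_Mapping.keys q. m $ s = 0" for q
    unfolding poly_eval_pm_eval pm_eval_def
    by (rule sum.cong) (use that assms pmon_cong[of _ s x y] in auto)
  then show ?thesis
    unfolding rest_polys_def by force
qed

lemma rest_polys_monom: "m $ s = 0 \<Longrightarrow> of_rat c * pmon x m \<in> rest_polys x s"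
  unfolding rest_polys_def
  by (auto intro!: exI[of _ "Poly_Mapping.single m c"] split: if_splits)

lemma rest_polys_mult:
  assumes "a \<in> rest_polys x s" "b \<in> rest_polys x s"
  shows "a * b \<in> rest_polys x s"
proof -
  obtain p q where "a = poly_eval p x" "b = poly_eval q x"
    and "\<forall>m\<in>Poly_Mapping.keys p. m $ s = 0" "\<forall>m\<in>Poly_Mapping.keys q. m $ s = 0"
    using assms unfolding rest_polys_def by blast
  then show ?thesis
    unfolding rest_polys_def using keys_mult[of p q]
    by (auto intro!: exI[of _ "p * q"] simp: poly_eval_mult)
qed

lemma rest_polys_0: "0 \<in> rest_polys x s"
  using rest_polys_monom[of 0 s 0 x] by simp

lemma rest_polys_1: "1 \<in> rest_polys x s"
  using rest_polys_monom[of 0 s 1 x] by simp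

lemma rest_polys_power: "a \<in> rest_polys x s \<Longrightarrow> a ^ n \<in> rest_polys x s"
  by (induction n) (simp_all add: rest_polys_1 rest_polys_mult)

lemma rest_polys_add:
  assumes "a \<in> rest_polys x s" "b \<in> rest_polys x s"
  shows "a + b \<in> rest_polys x s"
proof -
  obtain p q where "a = poly_eval p x" "b = poly_eval q x"
    and "\<forall>m\<in>Poly_Mapping.keys p. m $ s = 0" "\<forall>m\<in>Poly_Mapping.keys q. m $ s = 0"
    using assms unfolding rest_polys_def by blast
  then show ?thesis
    unfolding rest_polys_def using Poly_Mapping.keys_add[of p q]
    by (auto intro!: exI[of _ "p + q"] simp: poly_eval_add)
qed

lemma rest_polys_sum: "(\<And>i. i \<in> I \<Longrightarrow> a i \<in> rest_polys x s) \<Longrightarrow> sum a I \<in> rest_polys x s"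
  by (induction I rule: infinite_finite_induct) (simp_all add: rest_polys_0 rest_polys_add)

lemma sum_Sigma_pair:
  assumes "finite A" "\<And>a. a \<in> A \<Longrightarrow> finite (B a)"
  shows "(\<Sum>i\<in>Sigma A B. f i) = (\<Sum>a\<in>A. \<Sum>b\<in>B a. f (a, b))"
  using assms by (simp add: sum.Sigma)

text \<open>Expanding the coefficients of \<open>f\<close> into monomials free of
  \<open>x $ s\<close> turns the root into a polynomial relation for \<open>x\<close> whose terms
  all have different exponents.\<close>

lemma alg_indep_transcendental:
  assumes indep: "alg_indep x" and coeffs: "\<And>k. coeff f k \<in> rest_polys x s"
    and root: "poly f (x $ s) = 0"
  shows "f = 0"
proof -
  have "\<forall>k. \<exists>q. coeff f k = poly_eval q x \<and> (\<forall>m\<in>Poly_Mapping.keys q. m $ s = 0)"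
    using coeffs unfolding rest_polys_def by blast
  then obtain q where q: "\<And>k. coeff f k = poly_eval (q k) x"
    and free: "\<And>k m. m \<in> Poly_Mapping.keys (q k) \<Longrightarrow> m $ s = 0"
    by metis
  let ?I = "Sigma {..degree f} (\<lambda>k. Poly_Mapping.keys (q k))"
  let ?h = "\<lambda>(k, m). m + axis s k :: nat^3"
  let ?c = "\<lambda>(k, m). Poly_Mapping.lookup (q k) m"
  \<comment> \<open>Since \<open>m\<close> and \<open>m'\<close> vanish at \<open>s\<close>, the
    entry at \<open>s\<close> recovers the degree \<open>k\<close>.\<close>
  have "k = k' \<and> m = m'"
    if "m + axis s k = m' + axis s k'" "m \<in> Poly_Mapping.keys (q k)" "m' \<in> Poly_Mapping.keys (q k')"
    for k k' m m'
  proof -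
    have "(m + axis s k) $ s = (m' + axis s k') $ s"
      using that(1) by simp
    then have "k = k'"
      using free that(2,3) by (simp add: axis_def)
    then show ?thesis
      using that(1) by simp
  qed
  then have inj: "inj_on ?h ?I"
    by (auto simp: inj_on_def)
  have "(\<Sum>i\<in>?I. of_rat (?c i) * pmon x (?h i)) = (\<Sum>k\<le>degree f. coeff f k * (x $ s) ^ k)"
    by (subst sum_Sigma_pair; simp add: q poly_eval_pm_eval pm_eval_def pmon_add
        pmon_axis sum_distrib_left sum_distrib_right mult_ac)
  then have "(\<Sum>i\<in>?I. of_rat (?c i) * pmon x (?h i)) = 0"
    using root by (simp add: poly_altdef)
  moreover have "finite ?I" by simp
  ultimately have "?c i = 0" if "i \<in> ?I" for i
    using alg_indep_family[OF indep _ inj, of ?c i] that by blast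
  then have "Poly_Mapping.lookup (q (degree f)) m = 0"
    if "m \<in> Poly_Mapping.keys (q (degree f))" for m
    using that by fastforce
  then have "lead_coeff f = 0"
    by (simp add: q poly_eval_def)
  then show ?thesis by simp
qed

text \<open>If \<open>x\<^sub>s\<close> is transcendental over the polynomials in the other variables, then so is
  \<open>P / x\<^sub>s\<close>: a relation \<open>f\<close> for \<open>P / x\<^sub>s\<close> gives the relation \<open>t\<^sup>d f(P / t)\<close> for \<open>x\<^sub>s\<close>.\<close>

lemma alg_indep_exchange:
  assumes indep: "alg_indep x" and P: "P \<in> rest_polys x s" "P \<noteq> 0"
    and y: "y $ s = P / x $ s" "\<And>j. j \<noteq> s \<Longrightarrow> y $ j = x $ j"
  shows "alg_indep y"
  unfolding alg_indep_def
proof (intro allI impI)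
  fix p :: polynomial3
  assume root: "poly_eval p y = 0"
  \<comment> \<open>\<open>m0\<close> deletes the entry at \<open>s\<close> from an exponent. Then
    \<open>f\<close> is \<open>p\<close> read as a univariate polynomial in \<open>y $ s\<close>,
    with coefficients in the variables that \<open>x\<close> and \<open>y\<close> share.\<close>
  define m0 where "m0 m = (\<chi> j. if j = s then 0 else m $ j)" for m :: "nat^3"
  let ?c = "\<lambda>m. of_rat (Poly_Mapping.lookup p m) * pmon x (m0 m)"
  define f where "f = (\<Sum>m\<in>Poly_Mapping.keys p. monom (?c m) (m $ s))"
  have m0: "m = m0 m + axis s (m $ s)" for m
    by (simp add: m0_def axis_def vec_eq_iff)
  have m0_s: "m0 m $ s = 0" for m
    by (simp add: m0_def)
  have pmon_y: "pmon y m = pmon x (m0 m) * (y $ s) ^ (m $ s)" for m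
    using pmon_add[of y "m0 m" "axis s (m $ s)"] pmon_cong[of "m0 m" s x y] m0_s y(2)
    by (simp add: pmon_axis flip: m0)
  have coeff_f: "coeff f k = (\<Sum>m\<in>{m\<in>Poly_Mapping.keys p. m $ s = k}. ?c m)" for k
    by (simp add: f_def coeff_sum sum.inter_filter)
  then have coeff_f_rest: "coeff f k \<in> rest_polys x s" for k
    by (auto intro!: rest_polys_sum rest_polys_monom m0_s)
  have xs: "x $ s \<noteq> 0"
    using indep by (rule alg_indep_nonzero)
  \<comment> \<open>This is f(P t), with root \<open>inverse (x $ s)\<close>; reversing its
    coefficients gives a polynomial with root \<open>x $ s\<close>, still with coefficients in the
    subring.\<close>
  let ?g = "pcompose f [:0, P:]"
  have coeff_g: "coeff ?g k = coeff f k * P ^ k" for k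
    using coeff_pcompose_linear[of f P k] by (simp add: mult_ac)
  have "poly f (y $ s) = 0"
    using root by (simp add: f_def poly_sum poly_monom poly_eval_pm_eval pm_eval_def pmon_y mult_ac)
  then have "poly ?g (inverse (x $ s)) = 0"
    by (simp add: poly_pcompose y(1) field_simps)
  then have "poly (reflect_poly ?g) (x $ s) = 0"
    using xs by (simp add: poly_reflect_poly_nz)
  moreover have "coeff (reflect_poly ?g) k \<in> rest_polys x s" for k
    by (simp add: coeff_reflect_poly coeff_g rest_polys_0 rest_polys_mult rest_polys_power
        coeff_f_rest P(1))
  ultimately have "reflect_poly ?g = 0"
    using alg_indep_transcendental[OF indep] by blast
  then have "?g = 0" by simp
  then have "coeff f k = 0" for k
    using coeff_g[of k] P(2) by simp
  then have sum0: "(\<Sum>m\<in>{m\<in>Poly_Mapping.keys p. m $ s = k}. ?c m) = 0" for k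
    by (simp add: coeff_f)
  \<comment> \<open>Among exponents with the same entry at \<open>s\<close>, \<open>m0\<close> is
    injective, so the vanishing of one coefficient of \<open>f\<close> kills each of its
    terms.\<close>
  have "Poly_Mapping.lookup p m = 0" if "m \<in> Poly_Mapping.keys p" for m
  proof (rule alg_indep_family[OF indep _ _ sum0[of "m $ s"]])
    show "inj_on m0 {n \<in> Poly_Mapping.keys p. n $ s = m $ s}"
    proof (rule inj_onI)
      fix n n' assume "n \<in> {n \<in> Poly_Mapping.keys p. n $ s = m $ s}"
        "n' \<in> {n \<in> Poly_Mapping.keys p. n $ s = m $ s}" "m0 n = m0 n'"
      then show "n = n'"
        using m0[of n] m0[of n'] by simp
    qed
  qed (use that in auto)
  then show "p = 0"
    by (metis in_keys_iff lookup_zero poly_mapping_eqI)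
qed

section \<open>The field generated by a triple\<close>

lemma frac_fieldI: "a = poly_eval p x / poly_eval q x \<Longrightarrow> poly_eval q x \<noteq> 0 \<Longrightarrow> a \<in> frac_field x"
  unfolding frac_field_def by blast

lemma poly_eval_frac_field: "poly_eval p x \<in> frac_field x"
  \<comment> \<open>The denominator has to stay a \<open>Poly_Mapping.single\<close> for
    \<open>poly_eval_single\<close> to apply.\<close>
  by (rule frac_fieldI[of _ p x "Poly_Mapping.single 0 1"]) (simp_all del: single_one)

lemma frac_field_mult:
  assumes "a \<in> frac_field x" "b \<in> frac_field x"
  shows "a * b \<in> frac_field x"
proof -
  obtain p q p' q' where "a = poly_eval p x / poly_eval q x" "b = poly_eval p' x / poly_eval q' x"
    and "poly_eval q x \<noteq> 0" "poly_eval q' x \<noteq> 0"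
    using assms unfolding frac_field_def by blast
  then show ?thesis
    by (intro frac_fieldI[of _ "p * p'" x "q * q'"]) (simp_all add: poly_eval_mult)
qed

lemma frac_field_add:
  assumes "a \<in> frac_field x" "b \<in> frac_field x"
  shows "a + b \<in> frac_field x"
proof -
  obtain p q p' q' where "a = poly_eval p x / poly_eval q x" "b = poly_eval p' x / poly_eval q' x"
    and "poly_eval q x \<noteq> 0" "poly_eval q' x \<noteq> 0"
    using assms unfolding frac_field_def by blast
  then show ?thesis
    by (intro frac_fieldI[of _ "p * q' + p' * q" x "q * q'"])
      (simp_all add: poly_eval_mult poly_eval_add add_frac_eq)
qed

lemma frac_field_inverse:
  assumes "a \<in> frac_field x"
  shows "inverse a \<in> frac_field x"
proof (cases "a = 0")
  case True
  then show ?thesis using assms by simp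
next
  case False
  obtain p q where "a = poly_eval p x / poly_eval q x" "poly_eval q x \<noteq> 0"
    using assms unfolding frac_field_def by blast
  with False show ?thesis
    by (intro frac_fieldI[of _ q x p]) auto
qed

lemma frac_field_divide: "a \<in> frac_field x \<Longrightarrow> b \<in> frac_field x \<Longrightarrow> a / b \<in> frac_field x"
  by (simp add: divide_inverse frac_field_mult frac_field_inverse)

lemma frac_field_of_rat: "of_rat c \<in> frac_field x"
  using poly_eval_frac_field[of "Poly_Mapping.single 0 c" x] by simp

lemma frac_field_power: "a \<in> frac_field x \<Longrightarrow> a ^ n \<in> frac_field x"
  using frac_field_of_rat[of 1 x] by (induction n) (simp_all add: frac_field_mult)

lemma frac_field_sum: "(\<And>i. i \<in> I \<Longrightarrow> a i \<in> frac_field x) \<Longrightarrow> sum a I \<in> frac_field x"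
  using frac_field_of_rat[of 0 x]
  by (induction I rule: infinite_finite_induct) (simp_all add: frac_field_add)

lemma frac_field_prod: "(\<And>i. i \<in> I \<Longrightarrow> a i \<in> frac_field x) \<Longrightarrow> prod a I \<in> frac_field x"
  using frac_field_of_rat[of 1 x]
  by (induction I rule: infinite_finite_induct) (simp_all add: frac_field_mult)

lemma frac_field_var: "x $ s \<in> frac_field x"
  using poly_eval_frac_field[of "Poly_Mapping.single (axis s 1) 1" x] by (simp add: pmon_axis)

lemma frac_field_mono:
  assumes "\<And>i. x $ i \<in> frac_field y"
  shows "frac_field x \<subseteq> frac_field y"
proof -
  have "poly_eval p x \<in> frac_field y" for p
    unfolding poly_eval_def
    by (intro frac_field_sum frac_field_mult frac_field_of_rat frac_field_prod frac_field_power assms)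
  then show ?thesis
    unfolding frac_field_def[of x] by (auto intro: frac_field_divide)
qed

text \<open>Because \<open>P\<close> avoids the coordinate \<open>s\<close>, it is also a polynomial
  in \<open>y\<close>. Hence \<open>x $ s = P / y $ s\<close> lies in the field generated by
  \<open>y\<close>, which is therefore everything.\<close>

lemma free_generators_exchange:
  assumes free: "free_generators x" and P: "P \<in> rest_polys x s" "P \<noteq> 0"
    and y: "y $ s = P / x $ s" "\<And>j. j \<noteq> s \<Longrightarrow> y $ j = x $ j"
  shows "free_generators y"
proof -
  have indep: "alg_indep x"
    using free by (simp add: free_generators_iff)
  have "P \<in> rest_polys y s"
    using P(1) y(2) rest_polys_cong[of s x y] by simp
  then have "P \<in> frac_field y"
    by (auto simp: rest_polys_def poly_eval_frac_field)
  then have "P / y $ s \<in> frac_field y"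
    by (intro frac_field_divide frac_field_var)
  then have "x $ s \<in> frac_field y"
    using P(2) by (simp add: y(1))
  then have "x $ i \<in> frac_field y" for i
    using frac_field_var[of y i] y(2)[of i] by (cases "i = s") simp_all
  then have "frac_field x \<subseteq> frac_field y"
    by (rule frac_field_mono)
  then show ?thesis
    using free alg_indep_exchange[OF indep P y] by (auto simp: free_generators_iff)
qed

subsection \<open>Mutations are involutions of the set of seeds\<close>

lemma pos_part_nonneg [simp]: "0 \<le> pos_part n"
  by (simp add: pos_part_def)

lemma pos_part_scale: "0 < d \<Longrightarrow> pos_part (d * n) = d * pos_part n"
  unfolding pos_part_def by (cases "0 \<le> n") (simp_all add: max_def mult_le_0_iff zero_le_mult_iff)

lemma pos_part_diff: "pos_part n - pos_part (- n) = n"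
  by (simp add: pos_part_def)

text \<open>This keeps the cluster variable \<open>s\<close> out of the exchange polynomial in
  direction \<open>s\<close>.\<close>

lemma skew_symmetrizable_diag: "skew_symmetrizable B \<Longrightarrow> B $ s $ s = 0"
proof -
  assume "skew_symmetrizable B"
  then obtain d :: "int^3" where "d $ s > 0" "d $ s * B $ s $ s = - (d $ s * B $ s $ s)"
    unfolding skew_symmetrizable_def by blast
  then have "d $ s * B $ s $ s = 0"
    by linarith
  with \<open>d $ s > 0\<close> show "B $ s $ s = 0"
    by simp
qed

context
  fixes \<Omega> :: "'k::field_char_0 seed" and s :: 3
  assumes seed: "is_seed \<Omega>"
begin

lemma exmat_diag: "exmat \<Omega> $ s $ s = 0"
  using seed skew_symmetrizable_diag by (simp add: is_seed_def)

lemma cluster_alg_indep: "alg_indep (cluster \<Omega>)"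
  using seed by (simp add: is_seed_def free_generators_iff)

text \<open>The integer exponents of \<open>exchange_poly\<close> are nonnegative; as natural
  numbers they exhibit it as the value of an ordinary polynomial.\<close>

definition exch_exp :: "nat \<Rightarrow> nat^3" where
  "exch_exp i = (\<chi> j. nat (int i * pos_part (exmat \<Omega> $ j $ s) +
      int (rdeg \<Omega> $ s - i) * pos_part (- (exmat \<Omega> $ j $ s))))"

lemma exchange_poly_pmon:
  "exchange_poly \<Omega> s =
     (\<Sum>i\<le>rdeg \<Omega> $ s. of_rat (of_nat (coeff (mutpoly \<Omega> $ s) i)) * pmon (cluster \<Omega>) (exch_exp i))"
  unfolding exchange_poly_def pmon_def exch_exp_def
  by (simp add: power_int_def)

lemma exchange_poly_rest: "exchange_poly \<Omega> s \<in> rest_polys (cluster \<Omega>) s"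
  unfolding exchange_poly_pmon
  by (intro rest_polys_sum rest_polys_monom) (simp add: exch_exp_def exmat_diag pos_part_def)

text \<open>Several \<open>i\<close> may give the same exponent, for instance when column
  \<open>s\<close> of the matrix is zero. The coefficients are nonnegative, so nothing cancels, and
  the term \<open>i = 0\<close> contributes \<open>1\<close>.\<close>

lemma exchange_poly_nonzero: "exchange_poly \<Omega> s \<noteq> 0"
proof
  define z :: "nat \<Rightarrow> rat" where "z i = of_nat (coeff (mutpoly \<Omega> $ s) i)" for i
  define p where "p = (\<Sum>i\<le>rdeg \<Omega> $ s. Poly_Mapping.single (exch_exp i) (z i))"
  assume "exchange_poly \<Omega> s = 0"
  then have "poly_eval p (cluster \<Omega>) = 0"
    by (simp add: exchange_poly_pmon p_def poly_eval_sum z_def)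
  then have "p = 0"
    using cluster_alg_indep by (simp add: alg_indep_def)
  then have "Poly_Mapping.lookup p (exch_exp 0) = 0"
    by simp
  then have "0 = (\<Sum>i\<le>rdeg \<Omega> $ s. z i when exch_exp i = exch_exp 0)"
    by (simp add: p_def lookup_sum lookup_single)
  also have "\<dots> \<ge> (z 0 when exch_exp 0 = exch_exp 0)"
    by (rule member_le_sum) (auto simp: when_def z_def)
  finally have "z 0 \<le> 0" by simp
  then show False
    using seed by (simp add: z_def is_seed_def)
qed

text \<open>The symmetrizer \<open>d\<close> of the old matrix also serves for the new one.\<close>

lemma skew_symmetrizable_mutate: "skew_symmetrizable (exmat (mutate s \<Omega>))"
proof -
  let ?B = "exmat \<Omega>"
  obtain d :: "int^3" where d: "\<And>i. d $ i > 0"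
    and skew: "\<And>i j. d $ i * ?B $ i $ j = - (d $ j * ?B $ j $ i)"
    using seed unfolding is_seed_def skew_symmetrizable_def by blast
  have pos: "d $ i * pos_part (?B $ i $ j) = d $ j * pos_part (- (?B $ j $ i))" for i j
    using skew[of i j] d pos_part_scale[of "d $ i" "?B $ i $ j"]
      pos_part_scale[of "d $ j" "- ?B $ j $ i"] by simp
  \<comment> \<open>The correction term of the mutation rule, without the factor
    \<open>rdeg \<Omega> $ s\<close>. It is skew-symmetrized by \<open>d\<close> on its own.\<close>
  define e where "e i j = pos_part (?B $ i $ s) * ?B $ s $ j + ?B $ i $ s * pos_part (- (?B $ s $ j))"
    for i j
  have skew_e: "d $ i * e i j = - (d $ j * e j i)" for i j
  proof -
    have "d $ i * e i j = (d $ i * pos_part (?B $ i $ s)) * ?B $ s $ j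
        + (d $ i * ?B $ i $ s) * pos_part (- (?B $ s $ j))"
      by (simp add: e_def algebra_simps)
    also have "\<dots> = (d $ s * pos_part (- (?B $ s $ i))) * ?B $ s $ j
        + (- (d $ s * ?B $ s $ i)) * pos_part (- (?B $ s $ j))"
      by (simp only: pos[of i s] skew[of i s])
    also have "\<dots> = pos_part (- (?B $ s $ i)) * (d $ s * ?B $ s $ j)
        - ?B $ s $ i * (d $ s * pos_part (- (?B $ s $ j)))"
      by (simp add: algebra_simps)
    also have "\<dots> = pos_part (- (?B $ s $ i)) * (- (d $ j * ?B $ j $ s))
        - ?B $ s $ i * (d $ j * pos_part (?B $ j $ s))"
      by (simp only: skew[of s j] pos[of j s])
    finally show ?thesis by (simp add: e_def algebra_simps)
  qed
  have skew_sum: "d $ i * (?B $ i $ j + c * e i j) = - (d $ j * (?B $ j $ i + c * e j i))" for i j c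
  proof -
    have "d $ i * (?B $ i $ j + c * e i j) = d $ i * ?B $ i $ j + c * (d $ i * e i j)"
      by (simp add: algebra_simps)
    also have "\<dots> = - (d $ j * ?B $ j $ i) + c * (- (d $ j * e j i))"
      by (simp only: skew[of i j] skew_e[of i j])
    finally show ?thesis by (simp add: algebra_simps)
  qed
  let ?B' = "exmat (mutate s \<Omega>)"
  have "d $ i * ?B' $ i $ j = - (d $ j * ?B' $ j $ i)" for i j
  proof (cases "i = s \<or> j = s")
    case True
    then have "?B' $ i $ j = - (?B $ i $ j)" "?B' $ j $ i = - (?B $ j $ i)"
      by (auto simp: mutate_def Let_def)
    then show ?thesis
      by (simp only: mult_minus_right skew[of i j] minus_minus)
  next
    case False
    let ?r = "int (rdeg \<Omega> $ s)"
    have "?B' $ i $ j = ?B $ i $ j + ?r * e i j" "?B' $ j $ i = ?B $ j $ i + ?r * e j i"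
      using False by (auto simp: mutate_def Let_def e_def)
    then show ?thesis
      by (simp only: skew_sum[of i j])
  qed
  with d show ?thesis
    unfolding skew_symmetrizable_def by blast
qed

lemma is_seed_mutate: "is_seed (mutate s \<Omega>)"
proof -
  have "free_generators (cluster (mutate s \<Omega>))"
    by (rule free_generators_exchange[where x = "cluster \<Omega>" and s = s and P = "exchange_poly \<Omega> s"])
      (use seed exchange_poly_rest exchange_poly_nonzero in \<open>simp_all add: is_seed_def mutate_def\<close>)
  moreover have "rdeg (mutate s \<Omega>) = rdeg \<Omega>" "mutpoly (mutate s \<Omega>) = mutpoly \<Omega>"
    by (simp_all add: mutate_def)
  ultimately show ?thesis
    using seed skew_symmetrizable_mutate unfolding is_seed_def by presburger
qed

text \<open>Column \<open>s\<close> changes sign, which exchanges the two monomials being mixed. The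
  palindromic coefficients absorb this through \<open>i\<close> going to \<open>r - i\<close>, and
  the changed cluster variable has exponent \<open>0\<close>.\<close>

lemma exchange_poly_mutate: "exchange_poly (mutate s \<Omega>) s = exchange_poly \<Omega> s"
proof -
  let ?r = "rdeg \<Omega> $ s" and ?z = "coeff (mutpoly \<Omega> $ s)"
  let ?t = "\<lambda>i. of_nat (?z i) * (\<Prod>j\<in>UNIV. (cluster \<Omega> $ j) powi
           (int i * pos_part (exmat \<Omega> $ j $ s) + int (?r - i) * pos_part (- (exmat \<Omega> $ j $ s))))"
  have sym: "?z (?r - i) = ?z i" if "i \<le> ?r" for i
    using seed that unfolding is_seed_def by metis
  have "exchange_poly (mutate s \<Omega>) s = (\<Sum>i\<le>?r. ?t (?r - i))"
    unfolding exchange_poly_def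
  proof (rule sum.cong)
    show "{..rdeg (mutate s \<Omega>) $ s} = {..?r}"
      by (simp add: mutate_def)
  next
    fix i assume "i \<in> {..?r}"
    then have i: "i \<le> ?r" by simp
    have "(cluster (mutate s \<Omega>) $ j) powi (int i * pos_part (exmat (mutate s \<Omega>) $ j $ s) +
            int (rdeg (mutate s \<Omega>) $ s - i) * pos_part (- (exmat (mutate s \<Omega>) $ j $ s))) =
        (cluster \<Omega> $ j) powi (int (?r - i) * pos_part (exmat \<Omega> $ j $ s) +
           int (?r - (?r - i)) * pos_part (- (exmat \<Omega> $ j $ s)))" for j
      using i by (cases "j = s") (simp_all add: mutate_def Let_def exmat_diag pos_part_def add.commute)
    then show "of_nat (coeff (mutpoly (mutate s \<Omega>) $ s) i) *
        (\<Prod>j\<in>UNIV. (cluster (mutate s \<Omega>) $ j) powi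
          (int i * pos_part (exmat (mutate s \<Omega>) $ j $ s) +
           int (rdeg (mutate s \<Omega>) $ s - i) * pos_part (- (exmat (mutate s \<Omega>) $ j $ s)))) = ?t (?r - i)"
      using sym[OF i] by (simp add: mutate_def)
  qed
  also have "\<dots> = exchange_poly \<Omega> s"
    unfolding exchange_poly_def
    by (rule sum.reindex_bij_witness[where i = "\<lambda>i. ?r - i" and j = "\<lambda>i. ?r - i"]) auto
  finally show ?thesis .
qed

lemma mutate_mutate: "mutate s (mutate s \<Omega>) = \<Omega>"
proof -
  let ?B = "exmat \<Omega>" and ?B' = "exmat (mutate s \<Omega>)" and ?B'' = "exmat (mutate s (mutate s \<Omega>))"
  have "?B'' $ i $ j = ?B $ i $ j" for i j
  proof (cases "i = s \<or> j = s")
    case True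
    then show ?thesis by (auto simp: mutate_def Let_def)
  next
    case False
    let ?r = "int (rdeg \<Omega> $ s)"
    \<comment> \<open>Row and column \<open>s\<close> have changed sign at the second mutation. The
      two corrections add up to this expression, which vanishes since
      \<open>pos_part n - pos_part (- n) = n\<close>.\<close>
    have "?B'' $ i $ j = ?B $ i $ j
        + ?r * ((pos_part (?B $ i $ s) - pos_part (- (?B $ i $ s))) * ?B $ s $ j
                - ?B $ i $ s * (pos_part (?B $ s $ j) - pos_part (- (?B $ s $ j))))"
      using False by (simp add: mutate_def Let_def algebra_simps)
    then show ?thesis
      by (simp add: pos_part_diff)
  qed
  then have "?B'' = ?B"
    by (simp add: vec_eq_iff)
  moreover have "cluster (mutate s (mutate s \<Omega>)) = cluster \<Omega>"
    using exchange_poly_mutate exchange_poly_nonzero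
    by (simp add: mutate_def vec_eq_iff)
  moreover have "rdeg (mutate s (mutate s \<Omega>)) = rdeg \<Omega>" "mutpoly (mutate s (mutate s \<Omega>)) = mutpoly \<Omega>"
    by (simp_all add: mutate_def)
  ultimately show ?thesis
    by (metis (mono_tags, lifting) seed.equality unit_eq old.unit.exhaust)
qed

end

section \<open>The mutations in the group of bijections of the set of seeds\<close>

lemma mutation_Bij: "mutation s \<in> Bij seeds"
proof -
  have "bij_betw (mutate s) seeds seeds"
    by (rule bij_betw_byWitness[where f' = "mutate s"])
      (auto simp: seeds_def mutate_mutate is_seed_mutate)
  then have "bij_betw (mutation s) seeds seeds"
    unfolding mutation_def by (simp cong: bij_betw_cong)
  then show ?thesis
    by (simp add: Bij_def mutation_def)
qed

lemma inv_mutation: "inv\<^bsub>BijGroup seeds\<^esub> (mutation s) = (mutation s :: 'k::field_char_0 seed \<Rightarrow> _)"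
proof (rule group.inv_equality[OF group_BijGroup])
  have "compose seeds (mutation s) (mutation s) = (\<lambda>\<Omega>\<in>seeds. \<Omega> :: 'k seed)"
    by (auto simp: compose_def mutation_def seeds_def mutate_mutate is_seed_mutate)
  then show "mutation s \<otimes>\<^bsub>BijGroup seeds\<^esub> mutation s = \<one>\<^bsub>BijGroup (seeds :: 'k seed set)\<^esub>"
    by (simp add: BijGroup_def mutation_Bij)
qed (simp_all add: BijGroup_def mutation_Bij)

text \<open>Membership in \<open>Bij seeds\<close> is carried through the induction because the
  product of \<open>BijGroup\<close> is composition only there. Inverses of generators need no
  separate closure of \<open>T\<close>, as mutations are involutions.\<close>

lemma generated_group_invariant:
  fixes g :: "'k::field_char_0 seed \<Rightarrow> 'k seed"
  assumes g: "g \<in> generated_group (mutation ` S)" and T: "T \<subseteq> seeds"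
    and step: "\<And>s \<Omega>. s \<in> S \<Longrightarrow> \<Omega> \<in> T \<Longrightarrow> mutate s \<Omega> \<in> T"
  shows "g \<in> Bij seeds \<and> (\<forall>\<Omega>\<in>T. g \<Omega> \<in> T)"
  using g unfolding generated_group_def
proof (induction rule: generate.induct)
  case one
  have "\<one>\<^bsub>BijGroup (seeds :: 'k seed set)\<^esub> = (\<lambda>\<Omega>\<in>seeds. \<Omega>)"
    by (simp add: BijGroup_def)
  then show ?case
    using T id_Bij by (metis restrict_apply' subsetD)
next
  case (incl h)
  then show ?case
    using T step by (auto simp: mutation_Bij) (auto simp: mutation_def)
next
  case (inv h)
  then show ?case
    using T step by (auto simp: mutation_Bij inv_mutation) (auto simp: mutation_def)
next
  case (eng h1 h2)
  then have bij: "h1 \<in> Bij seeds" "h2 \<in> Bij seeds"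
    by simp_all
  then have "h1 \<otimes>\<^bsub>BijGroup seeds\<^esub> h2 = compose seeds h1 h2"
    by (simp add: BijGroup_def)
  moreover have "compose seeds h1 h2 \<in> Bij seeds"
    using bij by (rule compose_Bij)
  ultimately show ?case
    using eng.IH T by (simp add: compose_eq subset_iff)
qed

subsection \<open>Invariance of the Laurent polynomial\<close>

lemma prod_UNIV_3:
  fixes h :: "3 \<Rightarrow> 'a::comm_monoid_mult"
  shows "prod h UNIV = h 1 * h 2 * h 3"
  unfolding UNIV_3 by (simp add: mult.assoc)

text \<open>Away from row and column \<open>s\<close>, the correction term is exactly
  \<open>-2\<close> times the entry.\<close>

lemma exmat_mutate_Omega37:
  fixes \<Omega> :: "'k::field_char_0 seed"
  assumes "exmat \<Omega> = exmat (Omega37 k1 k2 x) \<or> exmat \<Omega> = - exmat (Omega37 k1 k2 x)"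
    and "rdeg \<Omega> = rdeg (Omega37 k1 k2 x)"
  shows "exmat (mutate s \<Omega>) = - exmat \<Omega>"
  using assms exhaust_3[of s]
  by (auto simp: mutate_def Let_def Omega37_def vec_eq_iff forall_3 pos_part_def)

lemma exchange_poly_Omega37:
  fixes \<Omega> :: "'k::field_char_0 seed"
  assumes "exmat \<Omega> = exmat (Omega37 k1 k2 x) \<or> exmat \<Omega> = - exmat (Omega37 k1 k2 x)"
    and "rdeg \<Omega> = rdeg (Omega37 k1 k2 x)" "mutpoly \<Omega> = mutpoly (Omega37 k1 k2 x)"
    and y: "y = cluster \<Omega>"
  shows "exchange_poly \<Omega> 1 = y $ 2 ^ 4 + of_nat k1 * y $ 2 ^ 3 * y $ 3 + of_nat k2 * y $ 2 ^ 2 * y $ 3 ^ 2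
      + of_nat k1 * y $ 2 * y $ 3 ^ 3 + y $ 3 ^ 4" (is ?th1)
    and "exchange_poly \<Omega> 2 = y $ 1 + y $ 3 ^ 2" (is ?th2)
    and "exchange_poly \<Omega> 3 = y $ 1 + y $ 2 ^ 2" (is ?th3)
proof -
  let ?B = "exmat \<Omega>"
  have sum_4: "(\<Sum>i\<le>4. h i) = h 0 + h 1 + h 2 + h 3 + h 4"
    and sum_1: "(\<Sum>i\<le>1. h i) = h 0 + h 1" for h :: "nat \<Rightarrow> 'k"
    by (simp_all add: eval_nat_numeral)
  have Z1: "coeff [:1, k1, k2, k1, 1:] 0 = 1" "coeff [:1, k1, k2, k1, 1:] 1 = k1"
    "coeff [:1, k1, k2, k1, 1:] 2 = k2" "coeff [:1, k1, k2, k1, 1:] 3 = k1"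
    "coeff [:1, k1, k2, k1, 1:] 4 = 1"
    by (simp_all add: numeral_eq_Suc)
  have Z2: "coeff [:1, 1 :: nat:] 0 = 1" "coeff [:1, 1 :: nat:] 1 = 1"
    by simp_all
  have data: "rdeg \<Omega> $ 1 = 4" "rdeg \<Omega> $ 2 = 1" "rdeg \<Omega> $ 3 = 1"
    "mutpoly \<Omega> $ 1 = [:1, k1, k2, k1, 1:]" "mutpoly \<Omega> $ 2 = [:1, 1:]" "mutpoly \<Omega> $ 3 = [:1, 1:]"
    unfolding assms(2,3) by (simp_all add: Omega37_def)
  obtain e :: int where e: "e = 1 \<or> e = - 1"
    and B: "?B $ 1 $ 1 = 0" "?B $ 2 $ 1 = - e" "?B $ 3 $ 1 = e" "?B $ 1 $ 2 = e" "?B $ 2 $ 2 = 0"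
      "?B $ 3 $ 2 = - (2 * e)" "?B $ 1 $ 3 = - e" "?B $ 2 $ 3 = 2 * e" "?B $ 3 $ 3 = 0"
  proof (rule disjE[OF assms(1)])
    assume "?B = exmat (Omega37 k1 k2 x)"
    then show thesis by (intro that[of 1]) (simp_all add: Omega37_def)
  next
    assume "?B = - exmat (Omega37 k1 k2 x)"
    then show thesis by (intro that[of "- 1"]) (simp_all add: Omega37_def)
  qed
  show ?th1
    using e unfolding exchange_poly_def data sum_4 Z1 prod_UNIV_3 B y
    by (elim disjE) (simp_all add: pos_part_def algebra_simps)
  show ?th2 ?th3
    using e unfolding exchange_poly_def data sum_1 Z2 prod_UNIV_3 B y
    by (elim disjE; simp add: pos_part_def)+
qed

section \<open>The Laurent polynomial as a function of each cluster variable\<close>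

definition F37_value :: "nat \<Rightarrow> nat \<Rightarrow> 'k::field_char_0 \<Rightarrow> 'k \<Rightarrow> 'k \<Rightarrow> 'k" where
  "F37_value k1 k2 y1 y2 y3 =
     (y1^2 + y2^4 + y3^4 + 2 * y1 * (y2^2 + y3^2) + of_nat k1 * y2 * y3 * (y1 + y2^2 + y3^2)
       + of_nat k2 * y2^2 * y3^2) / (y1 * y2^2 * y3^2)"

lemma laurent_eval_F37:
  assumes "\<And>i. y $ i \<noteq> 0"
  shows "laurent_eval (F37 k1 k2 a b) y
    = of_rat a * F37_value k1 k2 (y $ 1) (y $ 2) (y $ 3) + of_rat b"
  using assms
  by (simp add: F37_def Let_def laurent_eval_add laurent_eval_mult laurent_eval_power
      F37_value_def prod_UNIV_3 power_int_minus divide_inverse mult_ac)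

lemma F37_value_mutate1:
  assumes "y1 \<noteq> 0" "y2 \<noteq> 0" "y3 \<noteq> 0"
    and "P = y2^4 + of_nat k1 * y2^3 * y3 + of_nat k2 * y2^2 * y3^2 + of_nat k1 * y2 * y3^3 + y3^4"
    and "P \<noteq> 0"
  shows "F37_value k1 k2 (P / y1) y2 y3 = F37_value k1 k2 y1 y2 y3"
proof -
  \<comment> \<open>In the first variable the numerator is a monic quadratic with constant term
    \<open>P\<close>.\<close>
  have form: "F37_value k1 k2 t y2 y3 =
      (t + P / t + 2 * (y2^2 + y3^2) + of_nat k1 * y2 * y3) / (y2^2 * y3^2)" if "t \<noteq> 0" for t
    using that assms(2,3) unfolding F37_value_def assms(4) by (simp add: field_simps power_numeral_reduce)
  show ?thesis
    using assms(1,5) by (simp add: form)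
qed

lemma F37_value_mutate2:
  assumes "y1 \<noteq> 0" "y2 \<noteq> 0" "y3 \<noteq> 0" and "P = y1 + y3^2" and "P \<noteq> 0"
  shows "F37_value k1 k2 y1 (P / y2) y3 = F37_value k1 k2 y1 y2 y3"
proof -
  \<comment> \<open>In the second variable the numerator is a monic quartic with constant term
    \<open>P^2\<close>, whose linear coefficient is \<open>P\<close> times the cubic one. Dividing
    by \<open>t^2\<close> pairs \<open>t\<close> with \<open>P / t\<close>.\<close>
  have form: "F37_value k1 k2 y1 t y3 =
      (t^2 + (P / t)^2 + 2 * y1 + of_nat k1 * y3 * (t + P / t) + of_nat k2 * y3^2) / (y1 * y3^2)"
    if "t \<noteq> 0" for t
    using that assms(1,3) unfolding F37_value_def assms(4) by (simp add: field_simps power_numeral_reduce)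
  show ?thesis
    using assms(2,5) by (simp add: form add_ac)
qed

text \<open>Reduces mutation in direction \<open>3\<close> to the computation for direction
  \<open>2\<close>.\<close>

lemma F37_value_swap: "F37_value k1 k2 y1 y2 y3 = F37_value k1 k2 y1 y3 y2"
  by (simp add: F37_value_def algebra_simps)

lemma laurent_eval_F37_mutate:
  fixes \<Omega> :: "'k::field_char_0 seed"
  assumes "is_seed \<Omega>"
    and "exmat \<Omega> = exmat (Omega37 k1 k2 x) \<or> exmat \<Omega> = - exmat (Omega37 k1 k2 x)"
    and "rdeg \<Omega> = rdeg (Omega37 k1 k2 x)" "mutpoly \<Omega> = mutpoly (Omega37 k1 k2 x)"
  shows "laurent_eval (F37 k1 k2 a b) (cluster (mutate s \<Omega>)) = laurent_eval (F37 k1 k2 a b) (cluster \<Omega>)"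
proof -
  let ?y = "cluster \<Omega>" and ?y' = "cluster (mutate s \<Omega>)"
  note P = exchange_poly_Omega37[OF assms(2-4) refl]
  note nz = exchange_poly_nonzero[OF assms(1)]
  have y: "?y $ i \<noteq> 0" for i
    using assms(1) by (intro alg_indep_nonzero cluster_alg_indep)
  have y': "?y' $ i \<noteq> 0" for i
    using assms(1) by (intro alg_indep_nonzero cluster_alg_indep is_seed_mutate)
  consider "s = 1" | "s = 2" | "s = 3"
    using exhaust_3[of s] by blast
  then have "F37_value k1 k2 (?y' $ 1) (?y' $ 2) (?y' $ 3) = F37_value k1 k2 (?y $ 1) (?y $ 2) (?y $ 3)"
  proof cases
    case 1
    then show ?thesis
      using F37_value_mutate1[OF y y y P(1) nz] by (simp add: mutate_def)
  next
    case 2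
    then show ?thesis
      using F37_value_mutate2[OF y y y P(2) nz] by (simp add: mutate_def)
  next
    case 3
    then show ?thesis
      using F37_value_mutate2[OF y y y P(3) nz]
      by (simp add: mutate_def F37_value_swap[of k1 k2 "?y $ 1" "?y $ 2"])
  qed
  then show ?thesis
    by (simp add: laurent_eval_F37 y y')
qed

lemma mutation_symmetry_Omega37:
  assumes "free_generators x"
  shows "mutation s \<in> mutation_symmetries (Omega37 k1 k2 x)"
proof -
  let ?\<Omega> = "Omega37 k1 k2 x"
  have "permute_seed id \<Omega> = \<Omega>" for \<Omega> :: "'a seed"
    by (simp add: permute_seed_def)
  then have eq: "mutation s = (perm_mutation id s :: 'a seed \<Rightarrow> _)"
    by (simp add: mutation_def perm_mutation_def fun_eq_iff restrict_def)
  have "mutation s ?\<Omega> = \<lparr>exmat = - exmat ?\<Omega>, cluster = cluster (mutate s ?\<Omega>),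
      rdeg = rdeg ?\<Omega>, mutpoly = mutpoly ?\<Omega>\<rparr>"
    using is_seed_Omega37[OF assms] exmat_mutate_Omega37[of ?\<Omega> k1 k2 x s]
    by (simp add: mutation_def seeds_def) (simp add: mutate_def)
  with eq show ?thesis
    unfolding mutation_symmetries_def using bij_id by fastforce
qed

theorem proposition3p25:
  fixes k1 k2 :: nat
    and x :: "'k::field_char_0^3"
    and \<Omega> :: "'k seed"
  assumes "free_generators x"
    and "\<Omega> = Omega37 k1 k2 x"
  shows "(\<forall>s. mutation s \<in> mutation_symmetries \<Omega>) \<and>
    (\<forall>a b :: rat. a \<noteq> 0 \<longrightarrow>
       F37 k1 k2 a b \<in>
         invariant_laurent_ring \<Omega> (generated_group {mutation 1, mutation 2, mutation 3}))"
proof (intro conjI allI impI)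
  show "mutation s \<in> mutation_symmetries \<Omega>" for s
    using mutation_symmetry_Omega37[OF assms(1)] by (simp add: assms(2))
next
  fix a b :: rat
  let ?F = "laurent_eval (F37 k1 k2 a b) :: 'k^3 \<Rightarrow> 'k"
  \<comment> \<open>The value of \<open>?F\<close> is fixed to the one at the initial seed, so
    \<open>g \<Omega> \<in> T\<close> contains the invariance under \<open>g\<close>. The data
    \<open>rdeg\<close> and \<open>mutpoly\<close> are recorded since the exchange polynomials
    depend on them.\<close>
  define T where "T = {\<Omega>'. is_seed \<Omega>' \<and> (exmat \<Omega>' = exmat \<Omega> \<or> exmat \<Omega>' = - exmat \<Omega>) \<and>
    rdeg \<Omega>' = rdeg \<Omega> \<and> mutpoly \<Omega>' = mutpoly \<Omega> \<and> ?F (cluster \<Omega>') = ?F (cluster \<Omega>)}"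
  have "mutate s \<Omega>' \<in> T" if "\<Omega>' \<in> T" for s \<Omega>'
    using that is_seed_mutate[of \<Omega>' s] exmat_mutate_Omega37[of \<Omega>' k1 k2 x s]
      laurent_eval_F37_mutate[of \<Omega>' k1 k2 x a b s]
    by (auto simp: T_def assms(2)) (auto simp: mutate_def)
  moreover have "\<Omega> \<in> T" "T \<subseteq> seeds"
    using is_seed_Omega37[OF assms(1)] by (auto simp: T_def seeds_def assms(2))
  ultimately have "g \<Omega> \<in> T" if "g \<in> generated_group (mutation ` {1, 2, 3})" for g
    using generated_group_invariant[OF that] by blast
  then show "F37 k1 k2 a b \<in>
      invariant_laurent_ring \<Omega> (generated_group {mutation 1, mutation 2, mutation 3})"
    by (auto simp: invariant_laurent_ring_def T_def)
qed

end
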